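(* (Completeness of $\mathrm{D}$.) Let $A$ be a formula. If $A$ is valid in propositional Dummett logic (i.e. $\rho\Vdash A$ in every linearly ordered Kripke model $\langle P,\leq,\rho,\Vdash\rangle$), then the procedure $\mathrm{D}(\{\mathbf{F_l}A\})$ described in the context returns a proof (a closed proof table for $\{\mathbf{F_l}A\}$ in $\mathbf{D_1}$).
   Context: Formulas, models, signs $\mathbf{T},\mathbf{F},\mathbf{F_l},\mathbf{F_n},\mathbf{T_n},\widehat{\mathbf{T}},\widetilde{\mathbf{T}}$: formulas over propositional variables and $\top,\bot$ with $\land,\lor,\to$; a model is $\langle P,\leq,\rho,\Vdash\rangle$ with $P$ linearly ordered with minimum $\rho$, forcing on atoms persistent, $\top$ always, $\bot$ never forced, extended as usual. Rules of the calculus $\mathbf{D_1}$ (premise / conclusions; $S$ a set of signed formulas not containing the displayed premise formulas): ($\mathbf{T}\land$) $S,\mathbf{T}(A\land B)$ / $S,\mathbf{T}A,\mathbf{T}B$; ($\mathbf{F_l}\land$) $S,\mathbf{F_l}(A\land B)$ / $S,\mathbf{F_l}A,\mathbf{T_n}B\mid S,\mathbf{T}A,\mathbf{F_l}B$; ($\mathbf{T}\lor$) $S,\mathbf{T}(A\lor B)$ / $S,\mathbf{T}A\mid S,\mathbf{T}B$; ($\mathbf{F_l}\lor$) $S,\mathbf{F_l}(A\lor B)$ / $S,\mathbf{F}A,\mathbf{F_l}B\mid S,\mathbf{F}B,\mathbf{F_l}A$; ($\mathbf{T}\to$) $S,\mathbf{T}(A\to B)$ / $S,\mathbf{T}B\mid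 S,\mathbf{F_l}A,\mathbf{T_n}B\mid S,\widetilde{\mathbf{T}}(A\to B)$; ($\mathbf{F_l}\to$) $S,\mathbf{F_l}(A\to B)$ / $S,\mathbf{T}A,\mathbf{F_l}B$; ($\mathbf{F}$-decide) $S,\mathbf{F}A$ / $S,\mathbf{F_l}A\mid S,\mathbf{F_n}A$; ($\widehat{\mathbf{T}}$-decide) $S,\widehat{\mathbf{T}}(A\to B)$ / $S,\mathbf{F_l}A,\mathbf{T_n}B\mid S,\widetilde{\mathbf{T}}(A\to B)$. These are the invertible rules; those with one conclusion are $\alpha$-rules, the others $\beta$-rules. The non-invertible rule ($\mathbf{F_n}\widetilde{\mathbf{T}}$): premise $S,\widetilde{\mathbf{T}}(A_1\to B_1),\dots,\widetilde{\mathbf{T}}(A_n\to B_n),\mathbf{F_n}C_{n+1},\dots,\mathbf{F_n}C_u$, conclusions $S_c,V_1,S_{\mathbf F}\mid\dots\mid S_c,V_n,S_{\mathbf F}\mid S_c,S_{\widehat{\mathbf T}},V_{n+1}\mid\dots\mid S_c,S_{\widehat{\mathbf T}},V_u$, with $S_{\mathbf F}=\{\mathbf{F}C_i:n<i\le u\}$, $S_{\widehat{\mathbf T}}=\{\widehat{\mathbf{T}}(A_i\to B_i):i\le n\}$, $V_j=\{\widehat{\mathbf{T}}(A_i\to B_i):i\ne j,i\le n\}\cup\{\mathbf{F_l}A_j,\mathbf{T_n}B_j\}$ ($j\le n$), $V_j=\{\mathbf{F}C_i:i\ne j,n<i\le u\}\cup\{\mathbf{F_l}C_j\}$ ($n<j\le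 u$), $S_c=\{\mathbf{T}A:\mathbf{T}A\in S\}\cup\{\mathbf{T}A:\mathbf{F_l}A\in S\}\cup\{\mathbf{T}A:\mathbf{T_n}A\in S\}$. A set is inconsistent if it contains $\mathbf{T}\bot$, or $\mathbf{T}A$ together with $\mathbf{F}A$ or with $\mathbf{F_l}A$. A closed proof table is a tree of rule applications all of whose leaves are inconsistent. Procedure $\mathrm{D}(S)$ (returns a closed proof table for $S$ or NULL), trying steps in order: (1) if $S$ is inconsistent, return the one-node proof $S$; (2) if an $\alpha$-rule applies to some formula $H\in S$, recurse on its conclusion; if that returns a proof $\pi$, return the table with root $S$ and subtree $\pi$, else NULL; (3) if a $\beta$-rule applies to some $H\in S$, recurse on each conclusion; if any returns NULL return NULL, else return the table with root $S$ and these subtrees; (4) if $S$ contains some $\widetilde{\mathbf{T}}$- or $\mathbf{F_n}$-formula, apply $\mathbf{F_n}\widetilde{\mathbf{T}}$ taking as displayed formulas all $\widetilde{\mathbf{T}}$- and $\mathbf{F_n}$-formulas of $S$, recurse on each conclusion; if any returns NULL return NULL, else return the combined table; (5) otherwise return NULL.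
   Formalization: A set also counts as inconsistent if it contains F⊤ or F_l⊤; without this the claim fails for the valid formula ⊤, since D({F_l⊤}) returns NULL. For formulas without ⊤ nothing changes. *)

theory Defs
  imports Main
begin

datatype 'v form =
    Var 'v
  | Top
  | Bot
  | And "'v form" "'v form"
  | Or "'v form" "'v form"
  | Imp "'v form" "'v form"

text \<open>The order is a set of pairs \<open>(\<alpha>, \<beta>)\<close>, read \<open>\<alpha> \<le> \<beta>\<close>.\<close>

definition linear_model :: "'w set \<Rightarrow> ('w \<times> 'w) set \<Rightarrow> 'w \<Rightarrow> ('w \<Rightarrow> 'v \<Rightarrow> bool) \<Rightarrow> bool" where
  "linear_model P le \<rho> V \<longleftrightarrow>
     linear_order_on P le \<and>
     \<rho> \<in> P \<and> (\<forall>\<alpha>\<in>P. (\<rho>, \<alpha>) \<in> le) \<and>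
     (\<forall>\<alpha> \<beta> p. (\<alpha>, \<beta>) \<in> le \<longrightarrow> V \<alpha> p \<longrightarrow> V \<beta> p)"

fun forces :: "'w set \<Rightarrow> ('w \<times> 'w) set \<Rightarrow> ('w \<Rightarrow> 'v \<Rightarrow> bool) \<Rightarrow> 'w \<Rightarrow> 'v form \<Rightarrow> bool" where
  "forces P le V \<alpha> (Var p) \<longleftrightarrow> V \<alpha> p"
| "forces P le V \<alpha> Top \<longleftrightarrow> True"
| "forces P le V \<alpha> Bot \<longleftrightarrow> False"
| "forces P le V \<alpha> (And A B) \<longleftrightarrow> forces P le V \<alpha> A \<and> forces P le V \<alpha> B"
| "forces P le V \<alpha> (Or A B) \<longleftrightarrow> forces P le V \<alpha> A \<or> forces P le V \<alpha> B"
| "forces P le V \<alpha> (Imp A B) \<longleftrightarrow>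
     (\<forall>\<beta>\<in>P. (\<alpha>, \<beta>) \<in> le \<longrightarrow> forces P le V \<beta> A \<longrightarrow> forces P le V \<beta> B)"

text \<open>Validity in all models whose worlds are drawn from the type \<open>'w\<close>; HOL cannot quantify
  over all types inside a formula.\<close>

definition dummett_valid :: "'w itself \<Rightarrow> 'v form \<Rightarrow> bool" where
  "dummett_valid _ A \<longleftrightarrow>
     (\<forall>(P :: 'w set) le \<rho> V. linear_model P le \<rho> V \<longrightarrow> forces P le V \<rho> A)"

text \<open>\<open>That A B\<close> and \<open>Ttilde A B\<close> stand for the signs \<open>T\<close>-hat and \<open>T\<close>-tilde on the implication
  \<open>A \<rightarrow> B\<close>, the only formulas to which these two signs are attached.\<close>

datatype 'v sform =
    T "'v form"
  | F "'v form"
  | Fl "'v form"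
  | Fn "'v form"
  | Tn "'v form"
  | That "'v form" "'v form"
  | Ttilde "'v form" "'v form"

text \<open>A set is inconsistent if it contains \<open>T \<bottom>\<close>, or \<open>T A\<close> together with \<open>F A\<close> or \<open>Fl A\<close>.
  As \<open>\<top>\<close> is always forced, \<open>T \<top>\<close> counts as a member of every set; no rule treats \<open>\<top>\<close>, so without
  this convention \<open>{Fl \<top>}\<close> would have no closed proof table.\<close>

definition inconsistent :: "'v sform set \<Rightarrow> bool" where
  "inconsistent S \<longleftrightarrow>
     T Bot \<in> S \<or> (\<exists>A. (T A \<in> S \<or> A = Top) \<and> (F A \<in> S \<or> Fl A \<in> S))"

text \<open>\<open>invertible_rule H Xs\<close>: some invertible rule has premise \<open>S, H\<close> and the conclusions \<open>S, X\<close>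
  for \<open>X\<close> in the list \<open>Xs\<close>.\<close>

inductive invertible_rule :: "'v sform \<Rightarrow> 'v sform set list \<Rightarrow> bool" where
  T_And: "invertible_rule (T (And A B)) [{T A, T B}]"
| Fl_And: "invertible_rule (Fl (And A B)) [{Fl A, Tn B}, {T A, Fl B}]"
| T_Or: "invertible_rule (T (Or A B)) [{T A}, {T B}]"
| Fl_Or: "invertible_rule (Fl (Or A B)) [{F A, Fl B}, {F B, Fl A}]"
| T_Imp: "invertible_rule (T (Imp A B)) [{T B}, {Fl A, Tn B}, {Ttilde A B}]"
| Fl_Imp: "invertible_rule (Fl (Imp A B)) [{T A, Fl B}]"
| F_decide: "invertible_rule (F A) [{Fl A}, {Fn A}]"
| That_decide: "invertible_rule (That A B) [{Fl A, Tn B}, {Ttilde A B}]"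

definition alpha_rule :: "'v sform \<Rightarrow> 'v sform set list \<Rightarrow> bool" where
  "alpha_rule H Xs \<longleftrightarrow> invertible_rule H Xs \<and> length Xs = 1"

definition beta_rule :: "'v sform \<Rightarrow> 'v sform set list \<Rightarrow> bool" where
  "beta_rule H Xs \<longleftrightarrow> invertible_rule H Xs \<and> length Xs > 1"

definition certain :: "'v sform set \<Rightarrow> 'v sform set" where
  "certain S = {T A | A. T A \<in> S} \<union> {T A | A. Fl A \<in> S} \<union> {T A | A. Tn A \<in> S}"

text \<open>The displayed formulas of the rule \<open>Fn Ttilde\<close> are given by the list \<open>ABs\<close> of the pairs
  \<open>(A\<^sub>i, B\<^sub>i)\<close> and the list \<open>Cs\<close> of the \<open>C\<^sub>i\<close>, both without repetitions.\<close>

definition displayed :: "('v form \<times> 'v form) list \<Rightarrow> 'v form list \<Rightarrow> 'v sform set" where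
  "displayed ABs Cs = {Ttilde A B | A B. (A, B) \<in> set ABs} \<union> {Fn C | C. C \<in> set Cs}"

definition jump_conclusions ::
  "'v sform set \<Rightarrow> ('v form \<times> 'v form) list \<Rightarrow> 'v form list \<Rightarrow> 'v sform set list" where
  "jump_conclusions S ABs Cs =
     map (\<lambda>(A, B). certain S
            \<union> ({That A' B' | A' B'. (A', B') \<in> set ABs - {(A, B)}} \<union> {Fl A, Tn B})
            \<union> {F C | C. C \<in> set Cs}) ABs
     @ map (\<lambda>C. certain S
            \<union> {That A B | A B. (A, B) \<in> set ABs}
            \<union> ({F C' | C'. C' \<in> set Cs - {C}} \<union> {Fl C})) Cs"

text \<open>\<open>D1_rule S Ss\<close>: \<open>S\<close> is the premise and \<open>Ss\<close> the list of conclusions of a rule application.\<close>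

inductive D1_rule :: "'v sform set \<Rightarrow> 'v sform set list \<Rightarrow> bool" where
  invertible: "H \<notin> S \<Longrightarrow> invertible_rule H Xs \<Longrightarrow> D1_rule (S \<union> {H}) (map (\<lambda>X. S \<union> X) Xs)"
| Fn_Ttilde: "distinct ABs \<Longrightarrow> distinct Cs \<Longrightarrow> ABs \<noteq> [] \<or> Cs \<noteq> [] \<Longrightarrow>
     S \<inter> displayed ABs Cs = {} \<Longrightarrow>
     D1_rule (S \<union> displayed ABs Cs) (jump_conclusions S ABs Cs)"

datatype 'v table = Table (root: "'v sform set") (subtables: "'v table list")

inductive closed_table :: "'v table \<Rightarrow> bool" where
  leaf: "inconsistent S \<Longrightarrow> closed_table (Table S [])"
| node: "D1_rule S (map root \<pi>s) \<Longrightarrow> (\<And>\<pi>. \<pi> \<in> set \<pi>s \<Longrightarrow> closed_table \<pi>) \<Longrightarrow>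
     closed_table (Table S \<pi>s)"

text \<open>The procedure leaves open which formula is treated in steps 2 and 3 and in which order the
  conclusions of \<open>Fn Ttilde\<close> are listed in step 4, hence it is rendered as a nondeterministic one.
  \<open>D_calls S Ss\<close>: on input \<open>S\<close> it may execute one of the steps 2, 3, 4 by calling itself
  recursively on the members of \<open>Ss\<close>.\<close>

inductive D_calls :: "'v sform set \<Rightarrow> 'v sform set list \<Rightarrow> bool" where
  step2: "\<not> inconsistent S \<Longrightarrow>
     H \<in> S \<Longrightarrow> alpha_rule H Xs \<Longrightarrow>
     D_calls S (map (\<lambda>X. (S - {H}) \<union> X) Xs)"
| step3: "\<not> inconsistent S \<Longrightarrow>
     \<not> (\<exists>H\<in>S. \<exists>Xs. alpha_rule H Xs) \<Longrightarrow>
     H \<in> S \<Longrightarrow> beta_rule H Xs \<Longrightarrow>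
     D_calls S (map (\<lambda>X. (S - {H}) \<union> X) Xs)"
| step4: "\<not> inconsistent S \<Longrightarrow>
     \<not> (\<exists>H\<in>S. \<exists>Xs. alpha_rule H Xs) \<Longrightarrow>
     \<not> (\<exists>H\<in>S. \<exists>Xs. beta_rule H Xs) \<Longrightarrow>
     ABs \<noteq> [] \<or> Cs \<noteq> [] \<Longrightarrow>
     distinct ABs \<Longrightarrow> set ABs = {(A, B). Ttilde A B \<in> S} \<Longrightarrow>
     distinct Cs \<Longrightarrow> set Cs = {C. Fn C \<in> S} \<Longrightarrow>
     D_calls S (jump_conclusions (S - displayed ABs Cs) ABs Cs)"

text \<open>\<open>D_returns S r\<close>: some run on input \<open>S\<close> returns \<open>r\<close>, where \<open>None\<close> stands for \<open>NULL\<close>.\<close>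

inductive D_returns :: "'v sform set \<Rightarrow> 'v table option \<Rightarrow> bool" where
  step1: "inconsistent S \<Longrightarrow> D_returns S (Some (Table S []))"
| recurse: "D_calls S Ss \<Longrightarrow> list_all2 D_returns Ss rs \<Longrightarrow>
     D_returns S (if None \<in> set rs then None else Some (Table S (map the rs)))"
| step5: "\<not> inconsistent S \<Longrightarrow> \<not> (\<exists>Ss. D_calls S Ss) \<Longrightarrow> D_returns S None"

text \<open>\<open>D_terminates S\<close>: no run on input \<open>S\<close> has an infinite chain of nested recursive calls.\<close>

inductive D_terminates :: "'v sform set \<Rightarrow> bool" where
  "(\<And>Ss S'. D_calls S Ss \<Longrightarrow> S' \<in> set Ss \<Longrightarrow> D_terminates S') \<Longrightarrow> D_terminates S"

end

theory Submission
  imports Defs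
begin

text \<open>Termination: every call decreases a weight summed over the set, except the steps from \<open>F\<close> to
  \<open>Fn\<close> and from \<open>That\<close> to \<open>Ttilde\<close>, which decrease the number of undecided formulas.
  Completeness: by induction on a run returning NULL, its input is realized at the minimum of a
  finite linear model. A jump step puts a new world below the model of a failed conclusion, and an
  input on which no step is possible is realized in one world.\<close>

section \<open>Termination\<close>

text \<open>The surcharges are dictated by the rules: the conclusion \<open>F A, Fl B\<close> of a
  disjunction and \<open>Ttilde A B\<close> of an implication weigh one more than the two
  subformulas together, so \<open>Or\<close> and \<open>Imp\<close> get 2, while 1 suffices for
  \<open>And\<close>.\<close>

fun weight :: "'v form \<Rightarrow> nat" where
  "weight (Var p) = 1"
| "weight Top = 1"
| "weight Bot = 1"
| "weight (And A B) = weight A + weight B + 1"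
| "weight (Or A B) = weight A + weight B + 2"
| "weight (Imp A B) = weight A + weight B + 2"

fun sweight :: "'v sform \<Rightarrow> nat" where
  "sweight (T A) = weight A"
| "sweight (Fl A) = weight A"
| "sweight (Tn A) = weight A"
| "sweight (F A) = weight A + 1"
| "sweight (Fn A) = weight A + 1"
| "sweight (That A B) = weight A + weight B + 1"
| "sweight (Ttilde A B) = weight A + weight B + 1"

fun undecided :: "'v sform \<Rightarrow> bool" where
  "undecided (F A) = True"
| "undecided (That A B) = True"
| "undecided _ = False"

lemma weight_pos: "weight A > 0"
  by (cases A) auto

text \<open>The weight comes first because a jump turns \<open>Fn\<close> and \<open>Ttilde\<close>
  back into the undecided \<open>F\<close> and \<open>That\<close>, so the second component may grow
  there.\<close>

definition call_order :: "('v sform set \<times> 'v sform set) set" where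
  "call_order = measures [sum sweight, \<lambda>S. card {H \<in> S. undecided H}]"

section \<open>Decrease of the measure along a single call\<close>

lemma sum_Un_le:
  fixes f :: "'a \<Rightarrow> nat"
  assumes "finite A" "finite B"
  shows "sum f (A \<union> B) \<le> sum f A + sum f B"
  using assms by (simp add: sum_Un_nat)

lemma sum_Un4_le:
  fixes f :: "'a \<Rightarrow> nat"
  assumes "finite A" "finite B" "finite C" "finite D"
  shows "sum f (A \<union> B \<union> C \<union> D) \<le> sum f A + sum f B + sum f C + sum f D"
proof -
  have "sum f (A \<union> B \<union> C \<union> D) \<le> sum f (A \<union> B \<union> C) + sum f D"
    by (rule sum_Un_le) (use assms in auto)
  also have "sum f (A \<union> B \<union> C) \<le> sum f (A \<union> B) + sum f C"
    by (rule sum_Un_le) (use assms in auto)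
  also have "sum f (A \<union> B) \<le> sum f A + sum f B"
    by (rule sum_Un_le) (use assms in auto)
  finally show ?thesis by simp
qed

lemma invertible_rule_finite: "invertible_rule H Xs \<Longrightarrow> X \<in> set Xs \<Longrightarrow> finite X"
  by (auto elim!: invertible_rule.cases)

lemma invertible_rule_decreases:
  assumes "invertible_rule H Xs" "X \<in> set Xs"
  shows "sum sweight X < sweight H \<or>
    sum sweight X = sweight H \<and> undecided H \<and> (\<forall>G\<in>X. \<not> undecided G)"
  using assms
  by cases (auto simp: weight_pos sum.insert_if)

lemma invertible_call_decreases:
  assumes "finite S" "H \<in> S" "invertible_rule H Xs" "X \<in> set Xs"
  shows "((S - {H}) \<union> X, S) \<in> call_order"
proof -
  have fX: "finite X" using invertible_rule_finite assms by blast
  have le: "sum sweight ((S - {H}) \<union> X) \<le> sum sweight (S - {H}) + sum sweight X"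
    using sum_Un_le fX assms(1) by blast
  have eq: "sum sweight S = sweight H + sum sweight (S - {H})"
    using assms(1,2) by (rule sum.remove)
  from invertible_rule_decreases[OF assms(3,4)] show ?thesis
  proof
    assume "sum sweight X < sweight H"
    then show ?thesis using le eq by (simp add: call_order_def)
  next
    assume a: "sum sweight X = sweight H \<and> undecided H \<and> (\<forall>G\<in>X. \<not> undecided G)"
    \<comment> \<open>\<open>X\<close> has no undecided member, so it cannot bring \<open>H\<close>
      back, and exactly \<open>H\<close> drops out of the count.\<close>
    then have "{G \<in> (S - {H}) \<union> X. undecided G} = {G \<in> S. undecided G} - {H}" by auto
    moreover have "card ({G \<in> S. undecided G} - {H}) < card {G \<in> S. undecided G}"
      using a assms(1,2) by (intro card_Diff1_less) auto
    ultimately show ?thesis using a le eq by (auto simp: call_order_def)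
  qed
qed

text \<open>As an image under a change of sign, \<open>certain S\<close> inherits finiteness and a
  weight bound from \<open>S\<close>: the map preserves weights on its restricted domain, and
  identifying, say, \<open>T A\<close> with \<open>Tn A\<close> can only lower the sum.\<close>

lemma certain_eq_image:
  "certain S = (\<lambda>H. case H of T A \<Rightarrow> T A | Fl A \<Rightarrow> T A | Tn A \<Rightarrow> T A | H \<Rightarrow> H) `
    {H \<in> S. case H of T A \<Rightarrow> True | Fl A \<Rightarrow> True | Tn A \<Rightarrow> True | _ \<Rightarrow> False}"
  (is "_ = ?f ` ?R")
proof (intro equalityI subsetI)
  fix G assume "G \<in> certain S"
  then consider A where "G = T A" "T A \<in> S" | A where "G = T A" "Fl A \<in> S"
    | A where "G = T A" "Tn A \<in> S"
    unfolding certain_def by blast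
  then show "G \<in> ?f ` ?R"
  proof cases
    case (1 A)
    then show ?thesis by (intro image_eqI[of _ _ "T A"]) simp_all
  next
    case (2 A)
    then show ?thesis by (intro image_eqI[of _ _ "Fl A"]) simp_all
  next
    case (3 A)
    then show ?thesis by (intro image_eqI[of _ _ "Tn A"]) simp_all
  qed
next
  fix G assume "G \<in> ?f ` ?R"
  then obtain H where "H \<in> ?R" "G = ?f H" by blast
  then show "G \<in> certain S" by (cases H) (auto simp: certain_def)
qed

lemma finite_certain: "finite S \<Longrightarrow> finite (certain S)"
  by (simp add: certain_eq_image)

lemma sum_certain_le:
  assumes "finite S"
  shows "sum sweight (certain S) \<le> sum sweight S"
proof -
  let ?R = "{H \<in> S. case H of T A \<Rightarrow> True | Fl A \<Rightarrow> True | Tn A \<Rightarrow> True | _ \<Rightarrow> False}"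
  let ?f = "\<lambda>H. case H of T A \<Rightarrow> T A | Fl A \<Rightarrow> T A | Tn A \<Rightarrow> T A | H \<Rightarrow> H"
  have "sum sweight (certain S) \<le> sum (sweight \<circ> ?f) ?R"
    unfolding certain_eq_image using assms by (intro sum_image_le) auto
  also have "\<dots> = sum sweight ?R"
    by (intro sum.cong) (auto split: sform.splits)
  also have "\<dots> \<le> sum sweight S"
    using assms by (intro sum_mono2) auto
  finally show ?thesis .
qed

text \<open>The weights of \<open>F\<close>, \<open>Fn\<close> and of \<open>That\<close>, \<open>Ttilde\<close> agree, so only the formula made
  last-unforced by the jump changes its weight.\<close>

lemma jump_decreases:
  assumes fS: "finite S" and ABs: "set ABs = {(A, B). Ttilde A B \<in> S}"
    and Cs: "set Cs = {C. Fn C \<in> S}"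
    and S': "S' \<in> set (jump_conclusions (S - displayed ABs Cs) ABs Cs)"
  shows "finite S' \<and> (S', S) \<in> call_order"
proof -
  let ?R = "S - displayed ABs Cs"
  let ?g = "\<lambda>(A, B). That A B"
  let ?t = "\<lambda>(A, B). Ttilde A B"
  have disp: "displayed ABs Cs = ?t ` set ABs \<union> Fn ` set Cs"
    by (force simp: displayed_def)
  have sub: "displayed ABs Cs \<subseteq> S" using ABs Cs by (auto simp: displayed_def)
  have "sum sweight (displayed ABs Cs) = sum sweight (?t ` set ABs) + sum sweight (Fn ` set Cs)"
    unfolding disp by (intro sum.union_disjoint) auto
  also have "sum sweight (?t ` set ABs) = (\<Sum>(A, B)\<in>set ABs. weight A + weight B + 1)"
    by (subst sum.reindex) (auto simp: inj_on_def intro!: sum.cong)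
  also have "sum sweight (Fn ` set Cs) = (\<Sum>C\<in>set Cs. weight C + 1)"
    by (subst sum.reindex) (auto simp: inj_on_def)
  finally have sd: "sum sweight (displayed ABs Cs) =
    (\<Sum>(A, B)\<in>set ABs. weight A + weight B + 1) + (\<Sum>C\<in>set Cs. weight C + 1)" .
  have sS: "sum sweight S = sum sweight ?R + sum sweight (displayed ABs Cs)"
    using sum.subset_diff[OF sub fS] by simp
  have fR: "finite ?R" using fS by simp
  have sc: "sum sweight (certain ?R) \<le> sum sweight ?R" by (rule sum_certain_le[OF fR])
  have fc: "finite (certain ?R)" by (rule finite_certain[OF fR])
  have sg: "sum sweight (?g ` X) = (\<Sum>(A, B)\<in>X. weight A + weight B + 1)" for X :: "('a form \<times> 'a form) set"
    by (subst sum.reindex) (auto simp: inj_on_def intro!: sum.cong)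
  have sF: "sum sweight (F ` X) = (\<Sum>C\<in>X. weight C + 1)" for X :: "'a form set"
    by (subst sum.reindex) (auto simp: inj_on_def)
  have g: "{That A B | A B. (A, B) \<in> X} = ?g ` X" for X :: "('a form \<times> 'a form) set" by force
  have F: "{F C | C. C \<in> X} = F ` X" for X :: "'a form set" by blast
  from S' consider (imp) A B where "(A, B) \<in> set ABs"
      "S' = certain ?R \<union> ?g ` (set ABs - {(A, B)}) \<union> {Fl A, Tn B} \<union> F ` set Cs"
    | (C) C where "C \<in> set Cs"
      "S' = certain ?R \<union> ?g ` set ABs \<union> F ` (set Cs - {C}) \<union> {Fl C}"
    unfolding jump_conclusions_def g F set_append set_map Un_assoc Un_iff image_iff Bex_def
      split_paired_Ex prod.case by blast
  then have "finite S' \<and> sum sweight S' < sum sweight S"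
  proof cases
    case imp
    let ?X = "?g ` (set ABs - {(A, B)})"
    have "sum sweight S' \<le> sum sweight (certain ?R) + sum sweight ?X + sum sweight {Fl A, Tn B}
        + sum sweight (F ` set Cs)"
      unfolding imp(2) using fc by (intro sum_Un4_le) auto
    \<comment> \<open>The pair singled out counts \<open>weight A + weight B + 1\<close> in the
      premise, one more than \<open>{Fl A, Tn B}\<close> in the conclusion; this is the whole strict
      decrease.\<close>
    moreover have "(\<Sum>(A, B)\<in>set ABs. weight A + weight B + 1) =
        weight A + weight B + 1 + sum sweight ?X"
      unfolding sg using imp(1) by (subst sum.remove[of _ "(A, B)"]) auto
    ultimately have "sum sweight S' < sum sweight S"
      using sd sS sc by (simp add: sF)
    then show ?thesis using fc imp(2) by simp
  next
    case C
    let ?X = "F ` (set Cs - {C})"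
    have "sum sweight S' \<le> sum sweight (certain ?R) + sum sweight (?g ` set ABs)
        + sum sweight ?X + sum sweight {Fl C}"
      unfolding C(2) using fc by (intro sum_Un4_le) auto
    moreover have "(\<Sum>C\<in>set Cs. weight C + 1) = weight C + 1 + sum sweight ?X"
      unfolding sF using C(1) by (subst sum.remove[of _ C]) auto
    ultimately have "sum sweight S' < sum sweight S"
      using sd sS sc by (simp add: sg)
    then show ?thesis using fc C(2) by simp
  qed
  then show ?thesis by (simp add: call_order_def)
qed

lemma D_calls_decreases:
  assumes "D_calls S Ss" "finite S" "S' \<in> set Ss"
  shows "finite S' \<and> (S', S) \<in> call_order"
  using assms
proof cases
  case (step2 H Xs)
  then show ?thesis
    using assms invertible_call_decreases invertible_rule_finite
    by (fastforce simp: alpha_rule_def)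
next
  case (step3 H Xs)
  then show ?thesis
    using assms invertible_call_decreases invertible_rule_finite
    by (fastforce simp: beta_rule_def)
next
  case (step4 ABs Cs)
  then show ?thesis using assms jump_decreases by blast
qed

text \<open>Finiteness is carried along the calls because \<open>sum\<close> and \<open>card\<close>
  measure something only on finite sets.\<close>

lemma D_terminates_finite:
  assumes "finite S"
  shows "D_terminates S"
proof -
  have "wf call_order" by (simp add: call_order_def)
  then show ?thesis using assms
    by (induction S rule: wf_induct_rule) (meson D_calls_decreases D_terminates.intros)
qed

section \<open>Runs\<close>

text \<open>Follow any one available call and choose a result for each of its arguments; where no
  call is available, step 1 or step 5 answers.\<close>

lemma D_returns_exists: "D_terminates S \<Longrightarrow> \<exists>r. D_returns S r"
proof (induction rule: D_terminates.induct)
  case (1 S)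
  consider "inconsistent S" | Ss where "D_calls S Ss" | "\<not> inconsistent S" "\<not> (\<exists>Ss. D_calls S Ss)"
    by blast
  then show ?case
  proof cases
    case 2
    then have "\<forall>S'\<in>set Ss. \<exists>r. D_returns S' r" using "1.IH" by blast
    then obtain f where "\<forall>S'\<in>set Ss. D_returns S' (f S')" by metis
    then have "list_all2 D_returns Ss (map f Ss)"
      by (simp add: list_all2_conv_all_nth)
    then show ?thesis using 2 D_returns.recurse by blast
  qed (use D_returns.step1 D_returns.step5 in blast)+
qed

lemma invertible_D1_rule:
  assumes "H \<in> S" "invertible_rule H Xs"
  shows "D1_rule S (map (\<lambda>X. (S - {H}) \<union> X) Xs)"
proof -
  have "(S - {H}) \<union> {H} = S" using assms(1) by blast
  then show ?thesis using D1_rule.invertible[of H "S - {H}" Xs] assms(2) by auto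
qed

text \<open>A call removes the treated formulas before adding the new ones, which supplies the side
  condition of \<open>D1_rule\<close> that the rest of the premise does not contain them.\<close>

lemma D_calls_D1_rule:
  assumes "D_calls S Ss"
  shows "D1_rule S Ss"
  using assms
proof cases
  case (step4 ABs Cs)
  then have "displayed ABs Cs \<subseteq> S" by (auto simp: displayed_def)
  then have "(S - displayed ABs Cs) \<union> displayed ABs Cs = S" by blast
  then show ?thesis
    using D1_rule.Fn_Ttilde[of ABs Cs "S - displayed ABs Cs"] step4 by auto
qed (auto simp: alpha_rule_def beta_rule_def intro: invertible_D1_rule)

text \<open>The root is part of the claim so that the roots of the subtables can be matched with the
  conclusions \<open>Ss\<close>.\<close>

lemma D_returns_closed_table:
  "D_returns S r \<Longrightarrow> r = Some \<pi> \<Longrightarrow> closed_table \<pi> \<and> root \<pi> = S"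
proof (induction arbitrary: \<pi> rule: D_returns.induct)
  case (step1 S)
  then show ?case by (auto intro: closed_table.leaf)
next
  case (recurse S Ss rs)
  then have none: "None \<notin> set rs" and \<pi>: "\<pi> = Table S (map the rs)"
    by (auto split: if_splits)
  have sub: "closed_table (the (rs ! i)) \<and> root (the (rs ! i)) = Ss ! i" if "i < length rs" for i
  proof -
    have "rs ! i = Some (the (rs ! i))"
      using none that by (metis nth_mem option.collapse)
    then show ?thesis using recurse.IH that by (auto simp: list_all2_conv_all_nth)
  qed
  have "length rs = length Ss" using recurse.IH by (simp add: list_all2_lengthD)
  then have "map root (map the rs) = Ss"
    using sub by (intro nth_equalityI) auto
  moreover have "closed_table \<pi>'" if "\<pi>' \<in> set (map the rs)" for \<pi>'
    using that sub by (auto simp: in_set_conv_nth)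
  ultimately show ?case
    using D_calls_D1_rule[OF recurse.hyps(1)] \<pi> by (auto intro: closed_table.node)
qed simp

section \<open>Countermodels\<close>

lemma linear_model_trans:
  "linear_model P le \<rho> V \<Longrightarrow> (\<alpha>, \<beta>) \<in> le \<Longrightarrow> (\<beta>, \<gamma>) \<in> le \<Longrightarrow> (\<alpha>, \<gamma>) \<in> le"
  by (auto simp: linear_model_def order_on_defs dest: transD)

lemma linear_model_field: "linear_model P le \<rho> V \<Longrightarrow> le \<subseteq> P \<times> P"
  by (auto simp: linear_model_def order_on_defs)

lemma linear_model_min: "linear_model P le \<rho> V \<Longrightarrow> \<alpha> \<in> P \<Longrightarrow> (\<rho>, \<alpha>) \<in> le"
  by (auto simp: linear_model_def)

lemma forces_persistent:
  assumes "linear_model P le \<rho> V" "(\<alpha>, \<beta>) \<in> le" "forces P le V \<alpha> A"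
  shows "forces P le V \<beta> A"
  using assms(2,3)
proof (induction A arbitrary: \<alpha> \<beta>)
  case (Var p)
  then show ?case using assms(1) by (auto simp: linear_model_def)
next
  case (Imp A B)
  then show ?case using linear_model_trans[OF assms(1)] by (auto; blast)
qed (simp; blast)+

text \<open>Weaker than the intended meaning of \<open>Fn\<close> and \<open>Ttilde\<close>, which also demand a later world
  refuting \<open>A\<close>; this suffices because only premises are ever realized from conclusions.\<close>

fun realizes :: "'w set \<Rightarrow> ('w \<times> 'w) set \<Rightarrow> ('w \<Rightarrow> 'v \<Rightarrow> bool) \<Rightarrow> 'w \<Rightarrow> 'v sform \<Rightarrow> bool" where
  "realizes P le V \<alpha> (T A) \<longleftrightarrow> forces P le V \<alpha> A"
| "realizes P le V \<alpha> (F A) \<longleftrightarrow> \<not> forces P le V \<alpha> A"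
| "realizes P le V \<alpha> (Fn A) \<longleftrightarrow> \<not> forces P le V \<alpha> A"
| "realizes P le V \<alpha> (Tn A) \<longleftrightarrow> (\<forall>\<beta>\<in>P. (\<alpha>, \<beta>) \<in> le \<longrightarrow> \<beta> \<noteq> \<alpha> \<longrightarrow> forces P le V \<beta> A)"
| "realizes P le V \<alpha> (Fl A) \<longleftrightarrow> \<not> forces P le V \<alpha> A \<and>
     (\<forall>\<beta>\<in>P. (\<alpha>, \<beta>) \<in> le \<longrightarrow> \<beta> \<noteq> \<alpha> \<longrightarrow> forces P le V \<beta> A)"
| "realizes P le V \<alpha> (That A B) \<longleftrightarrow> forces P le V \<alpha> (Imp A B) \<and> \<not> forces P le V \<alpha> A"
| "realizes P le V \<alpha> (Ttilde A B) \<longleftrightarrow> forces P le V \<alpha> (Imp A B) \<and> \<not> forces P le V \<alpha> A"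

text \<open>Finiteness of \<open>P\<close> guarantees a fresh world in an infinite type, to be
  placed below the model at the next jump.\<close>

definition realizable :: "'w itself \<Rightarrow> 'v sform set \<Rightarrow> bool" where
  "realizable _ S \<longleftrightarrow> (\<exists>(P :: 'w set) le \<rho> V. finite P \<and> linear_model P le \<rho> V \<and>
     (\<forall>H\<in>S. realizes P le V \<rho> H))"

text \<open>A countermodel of any single conclusion serves unchanged for the premise; persistence
  from \<rho> settles what must hold at the later worlds.\<close>

lemma invertible_rule_realizes:
  assumes "invertible_rule H Xs" "X \<in> set Xs" "linear_model P le \<rho> V"
    "\<forall>G\<in>X. realizes P le V \<rho> G"
  shows "realizes P le V \<rho> H"
proof -
  have rho: "\<rho> \<in> P" using assms(3) by (simp add: linear_model_def)
  have min: "\<And>\<alpha>. \<alpha> \<in> P \<Longrightarrow> (\<rho>, \<alpha>) \<in> le" using linear_model_min[OF assms(3)] .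
  note pers = forces_persistent[OF assms(3)]
  show ?thesis
    using assms(1,2,4)
  proof cases
    case (Fl_And A B)
    then show ?thesis using assms(2,4) pers[OF min] by auto
  next
    case (T_Imp A B)
    then show ?thesis using assms(2,4) pers by auto
  next
    case (Fl_Imp A B)
    then have B: "forces P le V \<beta> B" if "\<beta> \<in> P" "\<beta> \<noteq> \<rho>" for \<beta>
      using assms(2,4) that min by auto
    \<comment> \<open>Above \<rho> the implication holds because its consequent does, so \<rho> is
      the last world refuting it.\<close>
    have "forces P le V \<beta> (Imp A B)" if "\<beta> \<in> P" "\<beta> \<noteq> \<rho>" for \<beta>
      using pers B[OF that] by auto
    then show ?thesis using Fl_Imp assms(2,4) rho min by auto
  qed (use assms(2,4) in auto)
qed

section \<open>Inputs to which no invertible rule applies\<close>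

lemma invertible_rule_ex_iff:
  "(\<exists>Xs. invertible_rule H Xs) \<longleftrightarrow> (\<exists>Xs. alpha_rule H Xs) \<or> (\<exists>Xs. beta_rule H Xs)"
proof -
  have "length Xs \<ge> 1" if "invertible_rule H Xs" for Xs
    using that by cases auto
  then show ?thesis by (force simp: alpha_rule_def beta_rule_def)
qed

text \<open>All \<open>F\<close> and \<open>That\<close> formulas and all compound \<open>T\<close>
  and \<open>Fl\<close> formulas have a rule. Consistency removes \<open>T Bot\<close> and, by the
  convention on \<open>Top\<close>, also \<open>Fl Top\<close>.\<close>

lemma irreducible_cases:
  assumes "H \<in> S" "\<not> inconsistent S" "\<not> (\<exists>Xs. invertible_rule H Xs)"
  obtains p where "H = T (Var p)" | "H = T Top"
    | p where "H = Fl (Var p)" "T (Var p) \<notin> S" | "H = Fl Bot"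
    | A where "H = Tn A" | A where "H = Fn A" | A B where "H = Ttilde A B"
proof (cases H)
  case (T A)
  then show ?thesis
    using that assms by (cases A) (auto simp: inconsistent_def intro: invertible_rule.intros)
next
  case (Fl A)
  then show ?thesis
    using that assms by (cases A) (auto simp: inconsistent_def intro: invertible_rule.intros)
qed (use that assms in \<open>auto intro: invertible_rule.intros\<close>)

text \<open>All new pairs start at \<sigma>, so no old world sees it and forcing there is
  unaffected.\<close>

lemma forces_insert_below:
  assumes "linear_model P le \<rho> V" "\<sigma> \<notin> P" "\<alpha> \<in> P"
  shows "forces (insert \<sigma> P) (le \<union> {\<sigma>} \<times> insert \<sigma> P) (V(\<sigma> := U)) \<alpha> A \<longleftrightarrow> forces P le V \<alpha> A"
  using assms(3)
proof (induction A arbitrary: \<alpha>)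
  case (Var p)
  then show ?case using assms(2) by auto
next
  case (Imp A B)
  then show ?case using assms(2) linear_model_field[OF assms(1)] by (auto; blast)
qed auto

text \<open>The condition on \<open>U\<close> is persistence from \<sigma> to \<rho>; since \<rho>
  is the old minimum, it extends to all of \<open>P\<close>.\<close>

lemma linear_model_insert_below:
  assumes m: "linear_model P le \<rho> V" and \<sigma>: "\<sigma> \<notin> P" and U: "\<And>p. U p \<Longrightarrow> V \<rho> p"
  shows "linear_model (insert \<sigma> P) (le \<union> {\<sigma>} \<times> insert \<sigma> P) \<sigma> (V(\<sigma> := U))"
proof -
  have field: "le \<subseteq> P \<times> P" by (rule linear_model_field[OF m])
  have lin: "linear_order_on P le" using m by (simp add: linear_model_def)
  have "linear_order_on (insert \<sigma> P) (le \<union> {\<sigma>} \<times> insert \<sigma> P)"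
    unfolding order_on_defs
  proof (intro conjI)
    show "le \<union> {\<sigma>} \<times> insert \<sigma> P \<subseteq> insert \<sigma> P \<times> insert \<sigma> P" using field by blast
    show "refl_on (insert \<sigma> P) (le \<union> {\<sigma>} \<times> insert \<sigma> P)"
      using lin by (auto simp: order_on_defs refl_on_def)
    show "trans (le \<union> {\<sigma>} \<times> insert \<sigma> P)"
      using linear_model_trans[OF m] field \<sigma> by (intro transI) blast
    show "antisym (le \<union> {\<sigma>} \<times> insert \<sigma> P)"
      using lin field \<sigma> by (intro antisymI) (auto simp: order_on_defs dest: antisymD)
    show "total_on (insert \<sigma> P) (le \<union> {\<sigma>} \<times> insert \<sigma> P)"
      using lin by (auto simp: order_on_defs total_on_def)
  qed
  moreover have "(V(\<sigma> := U)) \<beta> p"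
    if "(\<alpha>, \<beta>) \<in> le \<union> {\<sigma>} \<times> insert \<sigma> P" "(V(\<sigma> := U)) \<alpha> p" for \<alpha> \<beta> p
    using that field \<sigma> m U by (auto simp: linear_model_def split: if_splits)
  ultimately show ?thesis by (auto simp: linear_model_def)
qed

text \<open>These disjunctions hold for both kinds of conclusion, so the model construction need not
  ask which displayed formula was singled out.\<close>

lemma jump_conclusions_members:
  assumes "S' \<in> set (jump_conclusions (S - displayed ABs Cs) ABs Cs)"
  shows "certain S \<subseteq> S'"
    and "\<And>A B. (A, B) \<in> set ABs \<Longrightarrow> That A B \<in> S' \<or> Fl A \<in> S' \<and> Tn B \<in> S'"
    and "\<And>C. C \<in> set Cs \<Longrightarrow> F C \<in> S' \<or> Fl C \<in> S'"
proof -
  have "certain (S - displayed ABs Cs) = certain S"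
    by (auto simp: certain_def displayed_def)
  then show "certain S \<subseteq> S'" using assms by (auto simp: jump_conclusions_def)
qed (use assms in \<open>auto simp: jump_conclusions_def\<close>)

text \<open>The new minimum \<sigma> accounts for \<open>S\<close> as follows:
  \<open>certain S\<close> holds at all old worlds, which gives the later part of \<open>Fl\<close>
  and \<open>Tn\<close>, and whatever fails at \<rho> fails at \<sigma>, which gives
  \<open>Fn\<close> and the refuted antecedents of \<open>Ttilde\<close>.\<close>

lemma jump_realizable:
  fixes S :: "'v sform set"
  assumes inf: "infinite (UNIV :: 'w set)"
    and cons: "\<not> inconsistent S" and irred: "\<And>H. H \<in> S \<Longrightarrow> \<not> (\<exists>Xs. invertible_rule H Xs)"
    and ABs: "set ABs = {(A, B). Ttilde A B \<in> S}" and Cs: "set Cs = {C. Fn C \<in> S}"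
    and S': "S' \<in> set (jump_conclusions (S - displayed ABs Cs) ABs Cs)"
    and real: "realizable TYPE('w) S'"
  shows "realizable TYPE('w) S"
proof -
  obtain P :: "'w set" and le \<rho> V where fin: "finite P" and m: "linear_model P le \<rho> V"
    and r: "\<And>H. H \<in> S' \<Longrightarrow> realizes P le V \<rho> H"
    using real by (auto simp: realizable_def)
  obtain \<sigma> where \<sigma>: "\<sigma> \<notin> P" using inf fin ex_new_if_finite by blast
  have \<rho>: "\<rho> \<in> P" using m by (simp add: linear_model_def)
  note mem = jump_conclusions_members[OF S']
  \<comment> \<open>\<sigma> forces only the variables that \<open>S\<close> demands, so that every
    \<open>Fl (Var p)\<close> in \<open>S\<close> is refuted there.\<close>
  define U where "U p \<longleftrightarrow> T (Var p) \<in> S" for p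
  let ?P = "insert \<sigma> P" and ?le = "le \<union> {\<sigma>} \<times> insert \<sigma> P" and ?V = "V(\<sigma> := U)"
  have "V \<rho> p" if "U p" for p
    using that r[of "T (Var p)"] mem(1) by (auto simp: U_def certain_def)
  then have m': "linear_model ?P ?le \<sigma> ?V" by (rule linear_model_insert_below[OF m \<sigma>])
  have old: "forces ?P ?le ?V \<alpha> A \<longleftrightarrow> forces P le V \<alpha> A" if "\<alpha> \<in> P" for \<alpha> A
    using forces_insert_below[OF m \<sigma> that] .
  have later: "forces P le V \<alpha> A" if "T A \<in> certain S" "\<alpha> \<in> P" for \<alpha> A
    using r[of "T A"] that mem(1) forces_persistent[OF m linear_model_min[OF m]] by auto
  have below: "\<not> forces ?P ?le ?V \<sigma> A" if "\<not> forces P le V \<rho> A" for A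
    using forces_persistent[OF m', of \<sigma> \<rho> A] old[OF \<rho>] that \<rho> by auto
  have "realizes ?P ?le ?V \<sigma> H" if H: "H \<in> S" for H
    using H cons irred[OF H]
  proof (cases rule: irreducible_cases)
    case (1 p)
    then show ?thesis using H by (simp add: U_def)
  next
    case (3 p)
    then show ?thesis using H old later[of "Var p"] \<sigma> by (auto simp: U_def certain_def)
  next
    case 4
    \<comment> \<open>This case is impossible: the jump turns \<open>Fl Bot\<close> into
      \<open>T Bot\<close>, which \<rho> would have to force.\<close>
    then show ?thesis using H later[of Bot \<rho>] \<rho> by (auto simp: certain_def)
  next
    case (5 A)
    then show ?thesis using H old later[of A] by (auto simp: certain_def)
  next
    case (6 A)
    then show ?thesis using H mem(3)[of A] Cs r below by fastforce
  next
    case (7 A B)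
    then have "That A B \<in> S' \<or> Fl A \<in> S' \<and> Tn B \<in> S'" using H mem(2) ABs by blast
    \<comment> \<open>If this implication was the one singled out, \<open>That A B\<close> is
      recovered by reading \<open>That_decide\<close> from its first conclusion back to its
      premise.\<close>
    then have "realizes P le V \<rho> (That A B)"
    proof
      assume a: "Fl A \<in> S' \<and> Tn B \<in> S'"
      show ?thesis
        using a r[of "Fl A"] r[of "Tn B"] m
        by (intro invertible_rule_realizes[OF That_decide, of "{Fl A, Tn B}"]) auto
    qed (rule r)
    then have nA: "\<not> forces P le V \<rho> A" and AB: "forces P le V \<rho> (Imp A B)" by auto
    \<comment> \<open>Since \<sigma> refutes \<open>A\<close>, the implication at \<sigma> only has
      to be checked at old worlds, where it is inherited from \<rho>.\<close>
    have "forces ?P ?le ?V \<beta> B" if "\<beta> \<in> ?P" "forces ?P ?le ?V \<beta> A" for \<beta>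
    proof -
      have "\<beta> \<in> P" using that below[OF nA] by auto
      then show ?thesis using that(2) old AB linear_model_min[OF m] by auto
    qed
    then show ?thesis using 7 below[OF nA] by simp
  qed simp
  then show ?thesis using fin m' unfolding realizable_def by (metis finite.insertI)
qed

text \<open>A finite \<open>S\<close> always permits listing its \<open>Ttilde\<close> and
  \<open>Fn\<close> formulas, so being stuck means that there are none. What remains holds in one
  world, where the clauses about later worlds are vacuous.\<close>

lemma stuck_realizable:
  fixes S :: "'v sform set"
  assumes fin: "finite S" and cons: "\<not> inconsistent S" and stuck: "\<not> (\<exists>Ss. D_calls S Ss)"
  shows "realizable TYPE('w) S"
proof -
  have noalpha: "\<not> (\<exists>H\<in>S. \<exists>Xs. alpha_rule H Xs)"
    using stuck D_calls.step2[OF cons] by blast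
  then have nobeta: "\<not> (\<exists>H\<in>S. \<exists>Xs. beta_rule H Xs)"
    using stuck D_calls.step3[OF cons] by blast
  have irred: "\<not> (\<exists>Xs. invertible_rule H Xs)" if "H \<in> S" for H
    using that noalpha nobeta invertible_rule_ex_iff by blast
  have "{(A, B). Ttilde A B \<in> S} = (\<lambda>(A, B). Ttilde A B) -` S" by auto
  then have "finite {(A, B). Ttilde A B \<in> S}"
    using fin by (auto intro!: finite_vimageI simp: inj_on_def)
  then obtain ABs where ABs: "set ABs = {(A, B). Ttilde A B \<in> S}" "distinct ABs"
    using finite_distinct_list by blast
  have "{C. Fn C \<in> S} = Fn -` S" by auto
  then have "finite {C. Fn C \<in> S}"
    using fin by (auto intro!: finite_vimageI simp: inj_on_def)
  then obtain Cs where Cs: "set Cs = {C. Fn C \<in> S}" "distinct Cs"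
    using finite_distinct_list by blast
  have "ABs = [] \<and> Cs = []"
    using stuck D_calls.step4[OF cons noalpha nobeta _ ABs(2,1) Cs(2,1)] by blast
  then have none: "Ttilde A B \<notin> S" "Fn A \<notin> S" for A B using ABs Cs by auto
  \<comment> \<open>Any element of the type will do as the single world.\<close>
  define w :: 'w where "w = undefined"
  let ?V = "\<lambda>_ p. T (Var p) \<in> S"
  have "linear_model {w} {(w, w)} w ?V"
    by (auto simp: linear_model_def order_on_defs refl_on_def trans_def antisym_def total_on_def)
  moreover have "realizes {w} {(w, w)} ?V w H" if H: "H \<in> S" for H
    using H cons irred[OF H] by (cases rule: irreducible_cases) (use H none in auto)
  ultimately show ?thesis unfolding realizable_def by blast
qed

text \<open>A result \<open>None\<close> traces back to one argument of the call that returned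
  \<open>None\<close>; its model is passed on unchanged through steps 2 and 3 and extended by a
  world in step 4.\<close>

lemma D_returns_None_realizable:
  assumes inf: "infinite (UNIV :: 'w set)"
  shows "D_returns S r \<Longrightarrow> r = None \<Longrightarrow> finite S \<Longrightarrow> realizable TYPE('w) S"
proof (induction rule: D_returns.induct)
  case (recurse S Ss rs)
  then have "None \<in> set rs" by (simp split: if_splits)
  then obtain i where i: "i < length rs" "rs ! i = None" by (auto simp: in_set_conv_nth)
  define S' where "S' = Ss ! i"
  have "i < length Ss" using i recurse.IH by (auto dest: list_all2_lengthD)
  then have S': "S' \<in> set Ss" by (simp add: S'_def)
  have "finite S'" using D_calls_decreases recurse.hyps(1) recurse.prems(2) S' by blast
  then have real: "realizable TYPE('w) S'"
    using recurse.IH i by (auto simp: list_all2_conv_all_nth S'_def)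
  have inv: "realizable TYPE('w) S"
    if "H \<in> S" "invertible_rule H Xs" "X \<in> set Xs" "S' = (S - {H}) \<union> X" for H Xs X
  proof -
    obtain P :: "'w set" and le \<rho> V where m: "finite P" "linear_model P le \<rho> V"
      and r: "\<forall>G\<in>S'. realizes P le V \<rho> G"
      using real by (auto simp: realizable_def)
    have "realizes P le V \<rho> H"
      using r that by (intro invertible_rule_realizes[OF that(2,3) m(2)]) blast
    then have "\<forall>G\<in>S. realizes P le V \<rho> G" using r that(4) by blast
    then show ?thesis using m unfolding realizable_def by blast
  qed
  from recurse.hyps(1) show ?case
  proof cases
    case (step2 H Xs)
    then show ?thesis using inv S' by (auto simp: alpha_rule_def)
  next
    case (step3 H Xs)
    then show ?thesis using inv S' by (auto simp: beta_rule_def)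
  next
    case (step4 ABs Cs)
    then have "\<And>H. H \<in> S \<Longrightarrow> \<not> (\<exists>Xs. invertible_rule H Xs)"
      using invertible_rule_ex_iff by blast
    then show ?thesis using jump_realizable[OF inf] step4 S' real by blast
  qed
qed (auto intro: stuck_realizable)

theorem theorem2:
  fixes A :: "'v form"
  assumes "infinite (UNIV :: 'w set)"
    and "dummett_valid TYPE('w) A"
  shows "D_terminates {Fl A} \<and>
    (\<exists>r. D_returns {Fl A} r) \<and>
    (\<forall>r. D_returns {Fl A} r \<longrightarrow>
       (\<exists>\<pi>. r = Some \<pi> \<and> closed_table \<pi> \<and> root \<pi> = {Fl A}))"
proof -
  have fin: "D_terminates {Fl A}" by (simp add: D_terminates_finite)
  \<comment> \<open>A model realizing \<open>Fl A\<close> at its minimum would refute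
    \<open>A\<close> there, against validity.\<close>
  have "\<not> realizable TYPE('w) {Fl A}"
    using assms(2) by (auto simp: realizable_def dummett_valid_def)
  then have "\<not> D_returns {Fl A} None"
    using D_returns_None_realizable[OF assms(1)] by blast
  then show ?thesis
    using fin D_returns_exists D_returns_closed_table by (metis option.exhaust)
qed

end
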